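(* Let $h\in\mathbb{Z}$, $r\in\mathbb{N}$, $n\in\mathbb{Z}_+$ and $x\in\mathbb{Z}_p$. Define $$E_{n,w,q}^{(h,r)}(x)=\int_{\mathbb{Z}_p^r} w^{x_1+\cdots+x_r}[x+x_1+\cdots+x_r]_q^n\,q^{\sum_{i=1}^{r}(h-i+1)x_i}\,d\mu_{-1}(x_1)\cdots d\mu_{-1}(x_r).$$ Then $$E_{n,w,q}^{(h,r)}(x)=\frac{2^r}{(1-q)^n}\sum_{l=0}^{n}\frac{\binom{n}{l}(-1)^l q^{lx}}{(-q^{l+h}w:q^{-1})_r}=2^r\sum_{m=0}^{\infty}\binom{m+r-1}{m}_{q^{-1}}(-1)^m q^{hm}w^m[m+x]_q^n.$$
   Context: Let $p$ be a fixed odd prime, $\mathbb{Z}_p$ the ring of $p$-adic integers, $\mathbb{C}_p$ the completion of the algebraic closure of $\mathbb{Q}_p$, and $\mathbb{Z}_+=\mathbb{N}\cup\{0\}$. Let $q,w\in\mathbb{C}_p$ with $|1-q|_p<1$ and $|1-w|_p<1$. For $x\in\mathbb{Z}_p$ put $[x]_q=\frac{1-q^x}{1-q}$; $[k]_q!=[k]_q[k-1]_q\cdots[1]_q$; the $q$-binomial coefficient is $\binom{n}{k}_q=\frac{[n]_q[n-1]_q\cdots[n-k+1]_q}{[k]_q!}$; the $q$-shift factorial is $(a:q)_r=\prod_{j=0}^{r-1}(1-aq^j)$. For a uniformly differentiable function $f:\mathbb{Z}_p\to\mathbb{C}_p$, the fermionic $p$-adic integral is $\int_{\mathbb{Z}_p}f(x)\,d\mu_{-1}(x)=\lim_{N\to\infty}\sum_{x=0}^{p^N-1}f(x)(-1)^x$,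 and $\int_{\mathbb{Z}_p^r}$ denotes the $r$-fold iterated fermionic integral.
   Formalization: The infinite series diverges in C_p, so its sum is read formally: the value at t=1 of the rational function with expansion Σ a_m t^m. The series equality assumes q is not a root of unity, so that the q-binomials are defined; q≠1 is assumed throughout. *)

theory Defs
  imports "HOL-Analysis.Analysis" "HOL-Computational_Algebra.Polynomial_FPS"
begin

section \<open>The field of \<open>p\<close>-adic complex numbers\<close>

text \<open>
  A model of \<open>\<complex>\<^sub>p\<close> is a complete metric field whose metric comes from a multiplicative
  non-archimedean absolute value with \<open>\<bar>p\<bar> = 1/p\<close>.  The restriction of this absolute value to the
  prime field \<open>\<rat>\<close> is then the \<open>p\<close>-adic one, so by completeness the closure of \<open>\<rat>\<close>
  is \<open>\<rat>\<^sub>p\<close>.  The remaining two axioms of the locale say that the elements algebraic over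
  \<open>\<rat>\<^sub>p\<close> form an algebraic closure of \<open>\<rat>\<^sub>p\<close>, and that the whole field is the completion of
  this algebraic closure.  This determines the field up to isometric isomorphism.
\<close>

definition Qp :: "'a::{field_char_0, metric_space} set" where
  "Qp = closure \<rat>"

definition Qp_bar :: "'a::{field_char_0, metric_space} set" where
  "Qp_bar = {z. \<exists>P. P \<noteq> 0 \<and> (\<forall>i. coeff P i \<in> Qp) \<and> poly P z = 0}"

locale padic_complex =
  fixes p :: nat and pabs :: "'a::{field_char_0, complete_space} \<Rightarrow> real"
  assumes prime_p: "prime p"
    and dist_pabs: "dist x y = pabs (x - y)"
    and pabs_mult: "pabs (x * y) = pabs x * pabs y"
    and pabs_ultra: "pabs (x + y) \<le> max (pabs x) (pabs y)"
    and pabs_p: "pabs (of_nat p) = 1 / real p"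
    and Qp_bar_closed: "\<And>P :: 'a poly. (\<And>i. coeff P i \<in> Qp_bar) \<Longrightarrow> degree P > 0 \<Longrightarrow>
      \<exists>z\<in>Qp_bar. poly P z = 0"
    and Qp_bar_dense: "closure (Qp_bar :: 'a set) = UNIV"

text \<open>The closed unit ball of \<open>\<rat>\<^sub>p\<close>; in a model the distance to \<open>0\<close> is the absolute value.\<close>

definition Zp :: "'a::{field_char_0, metric_space} set" where
  "Zp = Qp \<inter> cball 0 1"


section \<open>\<open>q\<close>-analogues\<close>

text \<open>
  For \<open>\<bar>1 - q\<bar> < 1\<close> and \<open>x \<in> \<int>\<^sub>p\<close>, the power \<open>q\<^sup>x\<close> is given by the binomial series
  of \<open>(1 + (q - 1))\<^sup>x\<close>.
\<close>

definition ppow :: "'a::{field_char_0, metric_space} \<Rightarrow> 'a \<Rightarrow> 'a" where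
  "ppow q x = (\<Sum>m. (x gchoose m) * (q - 1) ^ m)"

definition qnum :: "'a::{field_char_0, metric_space} \<Rightarrow> 'a \<Rightarrow> 'a" where
  "qnum q x = (1 - ppow q x) / (1 - q)"

definition qfact :: "'a::{field_char_0, metric_space} \<Rightarrow> nat \<Rightarrow> 'a" where
  "qfact q k = (\<Prod>j=1..k. qnum q (of_nat j))"

definition qbinom :: "'a::{field_char_0, metric_space} \<Rightarrow> nat \<Rightarrow> nat \<Rightarrow> 'a" where
  "qbinom q n k = (\<Prod>j<k. qnum q (of_nat n - of_nat j)) / qfact q k"

definition qshift :: "'a::field \<Rightarrow> 'a \<Rightarrow> nat \<Rightarrow> 'a" where
  "qshift a q r = (\<Prod>j<r. 1 - a * q ^ j)"


section \<open>Fermionic integrals\<close>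

definition fermionic_integral ::
    "nat \<Rightarrow> ('a::{field_char_0, metric_space} \<Rightarrow> 'a) \<Rightarrow> 'a" where
  "fermionic_integral p f = lim (\<lambda>N. \<Sum>x<p ^ N. f (of_nat x) * (- 1) ^ x)"

text \<open>
  The integrand takes the family \<open>X 1, \<dots>, X r\<close>; the variable \<open>X 1\<close> is integrated innermost.
\<close>

primrec fermionic_integral_iter ::
    "nat \<Rightarrow> nat \<Rightarrow> ((nat \<Rightarrow> 'a::{field_char_0, metric_space}) \<Rightarrow> 'a) \<Rightarrow> 'a" where
  "fermionic_integral_iter p 0 f = f (\<lambda>_. 0)"
| "fermionic_integral_iter p (Suc r) f =
     fermionic_integral p (\<lambda>t. fermionic_integral_iter p r (\<lambda>X. f (X(Suc r := t))))"

definition twisted_q_Euler ::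
    "nat \<Rightarrow> int \<Rightarrow> nat \<Rightarrow> nat \<Rightarrow> 'a::{field_char_0, metric_space} \<Rightarrow> 'a \<Rightarrow> 'a \<Rightarrow> 'a" where
  "twisted_q_Euler p h r n w q x =
     fermionic_integral_iter p r (\<lambda>X.
       ppow w (\<Sum>i=1..r. X i) * qnum q (x + (\<Sum>i=1..r. X i)) ^ n *
       ppow q (\<Sum>i=1..r. (of_int h - of_nat i + 1) * X i))"


section \<open>Sums of series with rational generating function\<close>

text \<open>
  The series \<open>\<Sum>m. binom(m+r-1,m) (-1)\<^sup>m q\<^sup>h\<^sup>m w\<^sup>m [m+x]\<^sup>n\<close> has terms that do not tend to \<open>0\<close> when
  \<open>\<bar>1 - q\<bar> < 1\<close> and \<open>\<bar>1 - w\<bar> < 1\<close>, so it has no sum in the sense of \<^const>\<open>sums\<close>.  It is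
  a formal expansion: as a power series in \<open>w\<close> it is the expansion of a rational function, and
  its sum is the value of this rational function.  Accordingly \<open>\<Sum>m. a m\<close> is said to have sum
  \<open>s\<close> if the power series \<open>\<Sum>m. a m * t\<^sup>m\<close> is the expansion of a rational function of \<open>t\<close>
  that is regular at \<open>t = 1\<close> and takes the value \<open>s\<close> there.
\<close>

definition rational_sums :: "(nat \<Rightarrow> 'a::field) \<Rightarrow> 'a \<Rightarrow> bool" (infixr \<open>rational'_sums\<close> 80) where
  "a rational_sums s \<longleftrightarrow>
     (\<exists>P Q. poly Q 1 \<noteq> 0 \<and> fps_of_poly Q * Abs_fps a = fps_of_poly P \<and> s = poly P 1 / poly Q 1)"

lemma rational_sums_unique:
  assumes "a rational_sums s" "a rational_sums t"
  shows "s = t"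
proof -
  obtain P Q where 1: "poly Q 1 \<noteq> 0" "fps_of_poly Q * Abs_fps a = fps_of_poly P"
      "s = poly P 1 / poly Q 1"
    using assms(1) unfolding rational_sums_def by blast
  obtain P' Q' where 2: "poly Q' 1 \<noteq> 0" "fps_of_poly Q' * Abs_fps a = fps_of_poly P'"
      "t = poly P' 1 / poly Q' 1"
    using assms(2) unfolding rational_sums_def by blast
  have "fps_of_poly (Q' * P) = fps_of_poly (Q * P')"
    by (simp add: fps_of_poly_mult 1(2)[symmetric] 2(2)[symmetric] mult_ac)
  hence "Q' * P = Q * P'"
    by (simp only: fps_of_poly_eq_iff)
  hence "poly Q' 1 * poly P 1 = poly Q 1 * poly P' 1"
    by (metis poly_mult)
  thus ?thesis
    using 1(1) 2(1) unfolding 1(3) 2(3) by (simp add: frac_eq_eq mult_ac)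
qed

lemma rational_sums_geometric:
  fixes c :: "'a::field"
  assumes "c \<noteq> 1"
  shows "(\<lambda>m. c ^ m) rational_sums (1 / (1 - c))"
proof -
  have "fps_of_poly [:1, - c:] * Abs_fps (\<lambda>m. c ^ m) = fps_of_poly 1"
  proof (rule fps_ext)
    fix n
    show "fps_nth (fps_of_poly [:1, - c:] * Abs_fps (\<lambda>m. c ^ m)) n = fps_nth (fps_of_poly 1) n"
      by (cases n) (simp_all add: fps_of_poly_pCons algebra_simps)
  qed
  thus ?thesis
    unfolding rational_sums_def using assms
    by (intro exI[of _ 1] exI[of _ "[:1, - c:]"]) auto
qed

context padic_complex
begin

lemma tendsto_iff_pabs: "X \<longlonglongrightarrow> L \<longleftrightarrow> (\<lambda>N. pabs (X N - L)) \<longlonglongrightarrow> 0"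
  by (subst tendsto_dist_iff) (simp add: dist_pabs)

lemma pabs_nonneg: "pabs x \<ge> 0"
  by (metis diff_zero dist_pabs zero_le_dist)

lemma sums_add_pabs:
  fixes f g :: "nat \<Rightarrow> 'a"
  assumes "f sums s" "g sums t"
  shows "(\<lambda>m. f m + g m) sums (s + t)"
  unfolding sums_def tendsto_iff_pabs sum.distrib
proof (rule Lim_null_comparison)
  show "(\<lambda>N. pabs (sum f {..<N} - s) + pabs (sum g {..<N} - t)) \<longlonglongrightarrow> 0"
    using tendsto_add[OF assms[unfolded sums_def tendsto_iff_pabs]] by simp
  have "pabs (u + v) \<le> pabs u + pabs v" for u v
    using pabs_ultra[of u v] pabs_nonneg[of u] pabs_nonneg[of v] by linarith
  from this[of "sum f {..<N} - s" "sum g {..<N} - t" for N]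
  have "pabs (sum f {..<N} + sum g {..<N} - (s + t))
          \<le> pabs (sum f {..<N} - s) + pabs (sum g {..<N} - t)" for N
    by (simp only: add_diff_add)
  thus "\<forall>\<^sub>F N in sequentially. norm (pabs (sum f {..<N} + sum g {..<N} - (s + t)))
          \<le> pabs (sum f {..<N} - s) + pabs (sum g {..<N} - t)"
    by (simp add: pabs_nonneg)
qed

lemma sums_mult_pabs:
  fixes f :: "nat \<Rightarrow> 'a"
  assumes "f sums s"
  shows "(\<lambda>m. c * f m) sums (c * s)"
proof -
  have "(\<lambda>N. pabs c * pabs (sum f {..<N} - s)) \<longlonglongrightarrow> pabs c * 0"
    using assms unfolding sums_def tendsto_iff_pabs by (intro tendsto_intros)
  thus ?thesis
    unfolding sums_def tendsto_iff_pabs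
    by (simp add: pabs_mult[symmetric] right_diff_distrib sum_distrib_left)
qed

lemma sums_poly_mult:
  fixes a :: "nat \<Rightarrow> 'a"
  assumes "a sums S"
  shows "fps_nth (fps_of_poly Q * Abs_fps a) sums (poly Q 1 * S)"
proof (induction Q)
  case 0
  show ?case by (simp add: sums_0)
next
  case (pCons c Q)
  let ?F = "fps_of_poly Q * Abs_fps a"
  have "(\<lambda>m. fps_nth (fps_X * ?F) m) sums (poly Q 1 * S)"
    unfolding sums_def
  proof (rule LIMSEQ_imp_Suc)
    have "(\<Sum>m<Suc N. fps_nth (fps_X * ?F) m) = (\<Sum>m<N. fps_nth ?F m)" for N
      by (subst sum.lessThan_Suc_shift) (simp add: fps_X_mult_nth)
    thus "(\<lambda>N. \<Sum>m<Suc N. fps_nth (fps_X * ?F) m) \<longlonglongrightarrow> poly Q 1 * S"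
      using pCons.IH by (simp only: sums_def)
  qed
  from sums_add_pabs[OF sums_mult_pabs[OF assms, of c] this] show ?case
    by (simp add: fps_of_poly_pCons algebra_simps)
qed

text \<open>The sum agrees with the usual one whenever the series converges.\<close>

lemma rational_sums_eq_sums:
  fixes a :: "nat \<Rightarrow> 'a"
  assumes "a sums S" "a rational_sums s"
  shows "s = S"
proof -
  obtain P Q where PQ: "poly Q 1 \<noteq> 0" "fps_of_poly Q * Abs_fps a = fps_of_poly P"
      "s = poly P 1 / poly Q 1"
    using assms(2) unfolding rational_sums_def by blast
  have "coeff P sums (\<Sum>i\<le>degree P. coeff P i)"
    by (rule sums_finite) (auto simp: coeff_eq_0)
  hence "coeff P sums poly P 1"
    by (simp add: poly_altdef)
  moreover have "fps_nth (fps_of_poly P) = coeff P"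
    by (rule ext) simp
  hence "coeff P sums (poly Q 1 * S)"
    using sums_poly_mult[OF assms(1), of Q] PQ(2) by metis
  ultimately have "poly P 1 = poly Q 1 * S"
    unfolding sums_def by (rule LIMSEQ_unique)
  thus ?thesis
    using PQ by simp
qed

end

end

theory Submission
  imports Defs
begin

text \<open>
  On natural numbers the integrand is a finite linear combination, indexed by the \<open>l\<close> of the
  binomial expansion of \<open>(1 - q\<^sup>x q\<^sup>s)\<^sup>n\<close>, of products of exponentials \<open>a\<^sup>k\<close> with \<open>\<bar>1 - a\<bar> < 1\<close>.
  Since \<open>p\<close> is odd, \<open>\<Sum>k<p\<^sup>N. (-a)\<^sup>k = (1 + a\<^bsup>p\<^sup>N\<^esup>) / (1 + a)\<close>, and \<open>a\<^bsup>p\<^sup>N\<^esup> \<longlonglongrightarrow> a\<^sup>0 = 1\<close> because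
  \<open>t \<mapsto> a\<^sup>t\<close> is continuous on \<open>\<int>\<^sub>p\<close>; so each integration contributes a factor \<open>2 / (1 + a)\<close>.
  The identities for \<open>q\<^sup>x\<close> extend from \<open>\<nat>\<close> to \<open>\<int>\<^sub>p\<close> by density.
  The series follows from the \<open>q\<close>-binomial theorem
  \<open>\<Sum>m. binom(m+r-1,m)\<^sub>q z\<^sup>m t\<^sup>m = 1 / (zt : q)\<^sub>r\<close>, applied at \<open>q\<inverse>\<close> for each \<open>l\<close> separately.
\<close>

section \<open>Natural exponents: powers and the product form of the q-binomial coefficients\<close>

lemma ppow_of_nat:
  fixes q :: "'a::{field_char_0, metric_space}"
  shows "ppow q (of_nat k) = q ^ k"
proof -
  \<comment> \<open>The coefficients vanish beyond m = k, so the series is the finite binomial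
    expansion of (1 + (q - 1))^k.\<close>
  have "(\<lambda>m. (of_nat k gchoose m) * (q - 1) ^ m) sums (\<Sum>m\<le>k. (of_nat k gchoose m) * (q - 1) ^ m)"
    by (rule sums_finite) (auto simp flip: binomial_gbinomial)
  also have "(\<Sum>m\<le>k. (of_nat k gchoose m) * (q - 1) ^ m) = q ^ k"
    using binomial_ring[of "q - 1" 1 k] by (simp flip: binomial_gbinomial)
  finally show ?thesis
    unfolding ppow_def by (simp add: sums_iff)
qed

text \<open>Reading the numerator [r+m-1]...[r] backwards pairs [r+i] with the denominator factor
  [i+1], and 1 - q cancels. This is the form in which the q-binomial theorem is proved.\<close>

lemma qbinom_eq_prod:
  fixes q :: "'a::{field_char_0, metric_space}"
  assumes "r \<ge> 1" "q \<noteq> 1"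
  shows "qbinom q (m + r - 1) m = (\<Prod>i<m. (1 - q ^ (r + i)) / (1 - q ^ Suc i))"
proof -
  have "(\<Prod>j<m. qnum q (of_nat (m + r - 1) - of_nat j)) = (\<Prod>j<m. qnum q (of_nat (r + (m - Suc j))))"
  proof (rule prod.cong[OF refl])
    fix j assume "j \<in> {..<m}"
    then have "m + r - 1 = r + (m - Suc j) + j"
      using assms(1) by auto
    then show "qnum q (of_nat (m + r - 1) - of_nat j) = qnum q (of_nat (r + (m - Suc j)))"
      by (metis add_diff_cancel_right' of_nat_add)
  qed
  also have "\<dots> = (\<Prod>i<m. qnum q (of_nat (r + i)))"
    by (rule prod.nat_diff_reindex)
  finally have num: "(\<Prod>j<m. qnum q (of_nat (m + r - 1) - of_nat j)) = (\<Prod>i<m. qnum q (of_nat (r + i)))" .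
  have "qfact q m = (\<Prod>i<m. qnum q (of_nat (Suc i)))"
    unfolding qfact_def One_nat_def
    by (subst atLeastLessThanSuc_atLeastAtMost[symmetric], subst prod.atLeast_Suc_lessThan_Suc_shift)
      (simp add: lessThan_atLeast0)
  then show ?thesis
    unfolding qbinom_def num
    using assms(2) by (simp only: prod_dividef[symmetric] qnum_def ppow_of_nat) simp
qed

context padic_complex
begin

section \<open>Basic properties of \<open>pabs\<close> and its values on the integers\<close>

lemma pabs_0 [simp]: "pabs 0 = 0"
  by (metis diff_self dist_pabs dist_self)

lemma pabs_eq_0_iff [simp]: "pabs x = 0 \<longleftrightarrow> x = 0"
  by (metis diff_zero dist_eq_0_iff dist_pabs)

lemma pabs_1 [simp]: "pabs 1 = 1"
  using pabs_mult[of 1 1] by simp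

lemma pabs_minus_commute: "pabs (x - y) = pabs (y - x)"
  by (metis dist_commute dist_pabs)

lemma pabs_minus [simp]: "pabs (- x) = pabs x"
  using pabs_minus_commute[of 0 x] by simp

lemma pabs_diff_ultra: "pabs (x - y) \<le> max (pabs x) (pabs y)"
  using pabs_ultra[of x "- y"] by simp

lemma pabs_power: "pabs (x ^ k) = pabs x ^ k"
  by (induction k) (simp_all add: pabs_mult)

lemma pabs_inverse: "pabs (inverse x) = inverse (pabs x)"
proof (cases "x = 0")
  case False
  then have "pabs x * pabs (inverse x) = 1"
    by (simp flip: pabs_mult)
  then show ?thesis
    by (metis inverse_unique)
qed simp

lemma pabs_of_nat_le_1: "pabs (of_nat k) \<le> 1"
proof (induction k)
  case (Suc k)
  then show ?case
    using pabs_ultra[of 1 "of_nat k"] by simp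
qed simp

lemma pabs_of_int_le_1: "pabs (of_int k) \<le> 1"
  by (cases k) (simp_all add: pabs_of_nat_le_1 del: of_nat_Suc)

lemma p_gt_1: "p > 1"
  using prime_p by (rule prime_gt_1_nat)

text \<open>By Bezout 1 = uk + vp; if |k| < 1, both terms and hence their sum would have absolute
  value below 1.\<close>

lemma pabs_of_int_eq_1:
  assumes "coprime k (int p)"
  shows "pabs (of_int k) = 1"
proof (rule ccontr)
  assume "pabs (of_int k) \<noteq> 1"
  then have less: "pabs (of_int k) < 1"
    using pabs_of_int_le_1[of k] by simp
  obtain u v where "u * k + v * int p = 1"
    using assms bezout_int[of k "int p"] by auto
  then have "(of_int u * of_int k + of_int v * of_nat p :: 'a) = 1"
    by (metis of_int_1 of_int_add of_int_mult of_int_of_nat_eq)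
  then have "1 \<le> max (pabs (of_int u * of_int k)) (pabs (of_int v * of_nat p))"
    using pabs_ultra[of "of_int u * of_int k" "of_int v * of_nat p"] by simp
  moreover have "pabs (of_int u * of_int k) < 1"
    using mult_left_le_one_le[OF pabs_nonneg[of "of_int k"] pabs_nonneg pabs_of_int_le_1, of u] less
    by (simp add: pabs_mult)
  moreover have "pabs (of_nat p) < 1"
    using p_gt_1 by (simp add: pabs_p)
  then have "pabs (of_int v * of_nat p) < 1"
    using mult_left_le_one_le[OF pabs_nonneg[of "of_nat p"] pabs_nonneg pabs_of_int_le_1, of v]
    by (simp add: pabs_mult)
  ultimately show False
    by simp
qed

lemma pabs_of_int_dvd_le:
  assumes "int p ^ N dvd k"
  shows "pabs (of_int k) \<le> (1 / real p) ^ N"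
proof -
  obtain d where "k = int p ^ N * d"
    using assms by (elim dvdE)
  then have "pabs (of_int k) = (1 / real p) ^ N * pabs (of_int d)"
    by (simp add: pabs_mult pabs_power pabs_p)
  also have "\<dots> \<le> (1 / real p) ^ N"
    by (intro mult_left_le pabs_of_int_le_1) simp
  finally show ?thesis .
qed

section \<open>Continuity of the field operations for the metric of \<open>pabs\<close>\<close>

lemma tendsto_add_pabs:
  fixes X Y :: "nat \<Rightarrow> 'a"
  assumes "X \<longlonglongrightarrow> a" "Y \<longlonglongrightarrow> b"
  shows "(\<lambda>k. X k + Y k) \<longlonglongrightarrow> a + b"
  unfolding tendsto_iff_pabs
proof (rule Lim_null_comparison)
  show "(\<lambda>k. max (pabs (X k - a)) (pabs (Y k - b))) \<longlonglongrightarrow> 0"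
    using tendsto_max[OF assms[unfolded tendsto_iff_pabs]] by simp
  show "\<forall>\<^sub>F k in sequentially. norm (pabs (X k + Y k - (a + b))) \<le> max (pabs (X k - a)) (pabs (Y k - b))"
    using pabs_ultra[of "X k - a" "Y k - b" for k]
    by (auto intro!: always_eventually simp: pabs_nonneg add_diff_add simp del: max.bounded_iff le_max_iff_disj)
qed

lemma tendsto_mult_left_pabs:
  fixes X :: "nat \<Rightarrow> 'a"
  assumes "X \<longlonglongrightarrow> a"
  shows "(\<lambda>k. c * X k) \<longlonglongrightarrow> c * a"
proof -
  have "(\<lambda>k. pabs c * pabs (X k - a)) \<longlonglongrightarrow> pabs c * 0"
    using assms unfolding tendsto_iff_pabs by (intro tendsto_intros)
  then show ?thesis
    unfolding tendsto_iff_pabs by (simp add: pabs_mult[symmetric] right_diff_distrib)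
qed

text \<open>Writes XY as (X - a)(Y - b) + bX + aY - ab: the first term tends to 0 by
  multiplicativity of \<open>pabs\<close>, the rest is linear.\<close>

lemma tendsto_mult_pabs:
  fixes X Y :: "nat \<Rightarrow> 'a"
  assumes "X \<longlonglongrightarrow> a" "Y \<longlonglongrightarrow> b"
  shows "(\<lambda>k. X k * Y k) \<longlonglongrightarrow> a * b"
proof -
  have "(\<lambda>k. pabs (X k - a) * pabs (Y k - b)) \<longlonglongrightarrow> 0 * 0"
    using assms unfolding tendsto_iff_pabs by (intro tendsto_intros)
  then have "(\<lambda>k. (X k - a) * (Y k - b)) \<longlonglongrightarrow> 0"
    unfolding tendsto_iff_pabs by (simp add: pabs_mult)
  from tendsto_add_pabs[OF this tendsto_add_pabs[OF tendsto_mult_left_pabs[OF assms(1), of b]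
      tendsto_add_pabs[OF tendsto_mult_left_pabs[OF assms(2), of a] tendsto_const[of "- (a * b)"]]]]
  show ?thesis
    by (simp add: algebra_simps)
qed

lemma tendsto_power_pabs:
  fixes X :: "nat \<Rightarrow> 'a"
  assumes "X \<longlonglongrightarrow> a"
  shows "(\<lambda>k. X k ^ n) \<longlonglongrightarrow> a ^ n"
  by (induction n) (simp_all add: tendsto_mult_pabs assms)

lemma tendsto_sum_pabs:
  fixes X :: "'b \<Rightarrow> nat \<Rightarrow> 'a"
  assumes "\<And>l. l \<in> L \<Longrightarrow> X l \<longlonglongrightarrow> a l"
  shows "(\<lambda>k. \<Sum>l\<in>L. X l k) \<longlonglongrightarrow> (\<Sum>l\<in>L. a l)"
  using assms by (induction L rule: infinite_finite_induct) (simp_all add: tendsto_add_pabs)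

text \<open>Induction along the recurrence (m+1) C(b,m+1) = (b-m) C(b,m), which can be divided by
  m+1 in characteristic 0.\<close>

lemma tendsto_gbinomial_pabs:
  fixes X :: "nat \<Rightarrow> 'a"
  assumes "X \<longlonglongrightarrow> a"
  shows "(\<lambda>k. X k gchoose m) \<longlonglongrightarrow> a gchoose m"
proof (induction m)
  case (Suc m)
  have step: "b gchoose Suc m = inverse (of_nat (Suc m)) * ((b + - of_nat m) * (b gchoose m))" for b :: 'a
    using gbinomial_absorb_comp[of b m] gbinomial_absorption[of m b]
    by (simp add: field_simps del: of_nat_Suc)
  show ?case
    unfolding step
    by (intro tendsto_mult_left_pabs tendsto_mult_pabs tendsto_add_pabs Suc assms tendsto_const)
qed simp

section \<open>Density of the natural numbers in \<open>Zp\<close>\<close>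

lemma Zp_approx:
  fixes x :: 'a
  assumes "x \<in> Zp" "\<epsilon> > 0"
  obtains k :: nat where "pabs (x - of_nat k) < \<epsilon>"
proof -
  have x: "x \<in> closure \<rat>" "pabs x \<le> 1"
    using assms(1) dist_pabs[of x 0] by (auto simp: Zp_def Qp_def dist_commute)
  \<comment> \<open>A distance below 1 as well as below \<epsilon> forces |y| \<le> 1 by the
    ultrametric inequality.\<close>
  obtain y where y: "y \<in> \<rat>" "pabs (x - y) < min \<epsilon> 1"
    using x(1) \<open>\<epsilon> > 0\<close> unfolding closure_approachable
    by (metis dist_commute dist_pabs min_less_iff_conj zero_less_one)
  have y_le: "pabs y \<le> 1"
    using pabs_diff_ultra[of x "x - y"] x(2) y(2) by auto
  obtain a b where ab: "b > 0" "coprime a b" "y = of_int a / of_int b"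
    using Rats_cases'[OF y(1)] by metis
  \<comment> \<open>If p divided b, then |a| = 1 and |b| < 1, contradicting |a| = |y||b| \<le>
    |b|.\<close>
  have "coprime b (int p)"
  proof (rule ccontr)
    assume "\<not> coprime b (int p)"
    then have dvd: "int p dvd b"
      using prime_p prime_imp_coprime[of "int p" b] by (auto simp: coprime_commute)
    have "coprime a (int p)"
      using ab(2) dvd coprime_divisors[of a a "int p" b] by auto
    then have "pabs (of_int a) = 1"
      by (rule pabs_of_int_eq_1)
    moreover have "1 / real p < 1"
      using p_gt_1 by simp
    then have "pabs (of_int b) < 1"
      using pabs_of_int_dvd_le[of 1 b] dvd by simp
    moreover have "of_int a = y * of_int b"
      using ab by simp
    then have "pabs (of_int a) = pabs y * pabs (of_int b)"
      by (simp only: pabs_mult)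
    ultimately show False
      using y_le mult_left_le_one_le[OF pabs_nonneg pabs_nonneg y_le, of "of_int b"] by simp
  qed
  then have b1: "pabs (of_int b) = 1" and cop: "\<And>N. coprime b (int p ^ N)"
    by (simp_all add: pabs_of_int_eq_1)
  have "1 / real p < 1"
    using p_gt_1 by simp
  then obtain N where N: "(1 / real p) ^ N < \<epsilon>"
    using real_arch_pow_inv[OF \<open>\<epsilon> > 0\<close>] by blast
  obtain c v where c: "c * b + v * int p ^ N = 1"
    using cop[of N] bezout_int[of b "int p ^ N"] by auto
  \<comment> \<open>Here c inverts b modulo p^N, so k is the residue of a/b: p^N divides a - bk, and
    |b| = 1 carries the bound over to y - k.\<close>
  define k where "k = nat ((a * c) mod int p ^ N)"
  have k: "int k = (a * c) mod int p ^ N"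
    using p_gt_1 by (simp add: k_def)
  have "int p ^ N dvd a * c - int k"
    unfolding k by (simp add: dvd_minus_mod)
  moreover have "a - b * int k = a * (1 - c * b) + b * (a * c - int k)"
    by (simp add: algebra_simps)
  moreover have "1 - c * b = v * int p ^ N"
    using c by simp
  ultimately have "int p ^ N dvd a - b * int k"
    by (metis dvd_add dvd_mult dvd_triv_right)
  then have "pabs (of_int (a - b * int k)) < \<epsilon>"
    using pabs_of_int_dvd_le N by (meson order.strict_trans1)
  moreover have "of_int (a - b * int k) = (y - of_nat k) * of_int b"
    using ab by (simp add: field_simps)
  ultimately have "pabs (y - of_nat k) < \<epsilon>"
    by (simp only: pabs_mult b1 mult_1_right)
  then have "pabs (x - of_nat k) < \<epsilon>"
    using pabs_ultra[of "x - y" "y - of_nat k"] y(2) by auto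
  then show thesis
    by (rule that)
qed

text \<open>Naturals are rational and lie in the unit ball, so their limits lie in
  \<open>Zp\<close>. Together with \<open>Zp_approx\<close>, closure properties of \<open>Zp\<close>
  reduce to those of the naturals.\<close>

lemma Zp_I:
  fixes x :: 'a
  assumes "\<And>\<epsilon>. \<epsilon> > 0 \<Longrightarrow> \<exists>k::nat. pabs (x - of_nat k) < \<epsilon>"
  shows "x \<in> Zp"
proof -
  have "x \<in> closure \<rat>"
    unfolding closure_approachable by (metis assms Rats_of_nat dist_commute dist_pabs)
  moreover obtain k :: nat where "pabs (x - of_nat k) < 1"
    using assms[of 1] by auto
  then have "pabs x \<le> 1"
    using pabs_ultra[of "x - of_nat k" "of_nat k"] pabs_of_nat_le_1[of k] by simp
  ultimately show ?thesis
    using dist_pabs[of x 0] by (simp add: Zp_def Qp_def dist_commute)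
qed

lemma of_int_in_Zp [simp]: "(of_int k :: 'a) \<in> Zp"
  using pabs_of_int_le_1[of k] dist_pabs[of "of_int k" 0] closure_subset[of "\<rat> :: 'a set"]
  by (auto simp: Zp_def Qp_def dist_commute)

lemma of_nat_in_Zp [simp]: "(of_nat k :: 'a) \<in> Zp"
  using of_int_in_Zp[of "int k"] by simp

lemma Zp_seq:
  fixes x :: 'a
  assumes "x \<in> Zp"
  obtains K :: "nat \<Rightarrow> nat" where "(\<lambda>j. of_nat (K j)) \<longlonglongrightarrow> x"
proof -
  have "\<exists>k::nat. pabs (x - of_nat k) < inverse (real (Suc j))" for j
    using Zp_approx[OF assms, of "inverse (real (Suc j))"] by auto
  then obtain K where K: "\<And>j. pabs (x - of_nat (K j)) < inverse (real (Suc j))"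
    by metis
  have "(\<lambda>j. of_nat (K j)) \<longlonglongrightarrow> x"
    unfolding tendsto_iff_pabs
  proof (rule Lim_null_comparison[OF _ LIMSEQ_inverse_real_of_nat])
    show "\<forall>\<^sub>F j in sequentially. norm (pabs (of_nat (K j) - x)) \<le> inverse (real (Suc j))"
      using K by (auto intro!: always_eventually less_imp_le simp: pabs_nonneg pabs_minus_commute simp del: of_nat_Suc)
  qed
  then show thesis
    by (rule that)
qed

lemma Zp_add_of_nat:
  fixes x :: 'a
  assumes "x \<in> Zp"
  shows "x + of_nat k \<in> Zp"
proof (rule Zp_I)
  fix \<epsilon> :: real assume "\<epsilon> > 0"
  then obtain j :: nat where "pabs (x - of_nat j) < \<epsilon>"
    using Zp_approx assms by metis
  then show "\<exists>j::nat. pabs (x + of_nat k - of_nat j) < \<epsilon>"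
    by (intro exI[of _ "j + k"]) simp
qed

lemma Zp_of_nat_mult:
  fixes x :: 'a
  assumes "x \<in> Zp"
  shows "of_nat k * x \<in> Zp"
proof (rule Zp_I)
  fix \<epsilon> :: real assume "\<epsilon> > 0"
  then obtain j :: nat where j: "pabs (x - of_nat j) < \<epsilon>"
    using Zp_approx assms by metis
  have "pabs (of_nat k * (x - of_nat j)) \<le> pabs (x - of_nat j)"
    unfolding pabs_mult by (intro mult_left_le_one_le pabs_nonneg pabs_of_nat_le_1)
  with j show "\<exists>j::nat. pabs (of_nat k * x - of_nat j) < \<epsilon>"
    by (intro exI[of _ "k * j"]) (simp add: right_diff_distrib)
qed

section \<open>The binomial series of q^x: convergence and continuity in x\<close>

lemma pabs_gbinomial_le_1:
  fixes x :: 'a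
  assumes "x \<in> Zp"
  shows "pabs (x gchoose m) \<le> 1"
proof -
  obtain K :: "nat \<Rightarrow> nat" where "(\<lambda>j. of_nat (K j)) \<longlonglongrightarrow> x"
    using Zp_seq assms by blast
  then have "(\<lambda>j. of_nat (K j) gchoose m) \<longlonglongrightarrow> x gchoose m"
    by (rule tendsto_gbinomial_pabs)
  then have "\<forall>\<^sub>F j in sequentially. pabs ((of_nat (K j) gchoose m) - (x gchoose m)) < 1"
    unfolding tendsto_iff_pabs by (rule order_tendstoD) simp
  \<comment> \<open>A distance below 1 from an ordinary binomial coefficient, which has absolute
    value at most 1, suffices in the ultrametric setting.\<close>
  then obtain j where "pabs ((of_nat (K j) gchoose m) - (x gchoose m)) < 1"
    by (auto simp: eventually_sequentially)
  then show ?thesis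
    using pabs_diff_ultra[of "of_nat (K j) gchoose m" "(of_nat (K j) gchoose m) - (x gchoose m)"]
      pabs_of_nat_le_1[of "K j choose m"]
    by (auto simp flip: binomial_gbinomial)
qed

lemma pabs_sum_le:
  assumes "\<And>i. i \<in> A \<Longrightarrow> pabs (f i) \<le> B" "B \<ge> 0"
  shows "pabs (sum f A) \<le> B"
  using assms(1)
proof (induction A rule: infinite_finite_induct)
  case (insert i A)
  then have "pabs (f i) \<le> B" "pabs (sum f A) \<le> B"
    by auto
  then show ?case
    using pabs_ultra[of "f i" "sum f A"] insert.hyps by simp
qed (use assms(2) in auto)

text \<open>A sum is bounded by its largest term, and the coefficients have absolute value at most
  1. The bound does not depend on x, which later yields continuity.\<close>

lemma pabs_binomial_tail_le:
  fixes x :: 'a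
  assumes "pabs (1 - q) < 1" "x \<in> Zp" "M \<le> N"
  shows "pabs ((\<Sum>m<N. (x gchoose m) * (q - 1) ^ m) - (\<Sum>m<M. (x gchoose m) * (q - 1) ^ m))
    \<le> pabs (q - 1) ^ M"
proof -
  have "(\<Sum>m<N. (x gchoose m) * (q - 1) ^ m) - (\<Sum>m<M. (x gchoose m) * (q - 1) ^ m)
      = (\<Sum>m=M..<N. (x gchoose m) * (q - 1) ^ m)"
    using assms(3) by (simp add: sum_diff_nat_ivl lessThan_atLeast0)
  also have "pabs \<dots> \<le> pabs (q - 1) ^ M"
  proof (rule pabs_sum_le)
    fix m assume "m \<in> {M..<N}"
    then have "pabs (q - 1) ^ m \<le> pabs (q - 1) ^ M"
      using assms(1) by (intro power_decreasing) (auto simp: pabs_nonneg pabs_minus_commute)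
    moreover have "pabs ((x gchoose m) * (q - 1) ^ m) \<le> pabs (q - 1) ^ m"
      unfolding pabs_mult pabs_power
      by (intro mult_left_le_one_le pabs_gbinomial_le_1 assms) (auto simp: pabs_nonneg)
    ultimately show "pabs ((x gchoose m) * (q - 1) ^ m) \<le> pabs (q - 1) ^ M"
      by simp
  qed (simp add: pabs_nonneg)
  finally show ?thesis .
qed

lemma pabs_power_tendsto_0:
  assumes "pabs (1 - q) < 1"
  shows "(\<lambda>M. pabs (q - 1) ^ M) \<longlonglongrightarrow> 0"
  using assms by (intro LIMSEQ_realpow_zero) (auto simp: pabs_nonneg pabs_minus_commute)

text \<open>The tail bound makes the partial sums Cauchy, and the field is complete.\<close>

lemma ppow_sums:
  fixes x :: 'a
  assumes "pabs (1 - q) < 1" "x \<in> Zp"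
  shows "(\<lambda>m. (x gchoose m) * (q - 1) ^ m) sums ppow q x"
proof -
  have "Cauchy (\<lambda>N. \<Sum>m<N. (x gchoose m) * (q - 1) ^ m)"
  proof (rule metric_CauchyI)
    fix e :: real assume "e > 0"
    then have "\<forall>\<^sub>F M in sequentially. pabs (q - 1) ^ M < e"
      using pabs_power_tendsto_0[OF assms(1)] by (auto intro: order_tendstoD)
    then obtain M where M: "pabs (q - 1) ^ M < e"
      by (auto simp: eventually_sequentially)
    show "\<exists>M. \<forall>m\<ge>M. \<forall>n\<ge>M. dist (\<Sum>m<m. (x gchoose m) * (q - 1) ^ m)
        (\<Sum>m<n. (x gchoose m) * (q - 1) ^ m) < e"
    proof (intro exI allI impI)
      fix m n assume "m \<ge> M" "n \<ge> M"
      then show "dist (\<Sum>m<m. (x gchoose m) * (q - 1) ^ m) (\<Sum>m<n. (x gchoose m) * (q - 1) ^ m) < e"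
        using pabs_binomial_tail_le[OF assms, of M m] pabs_binomial_tail_le[OF assms, of M n] M
          pabs_diff_ultra[of "(\<Sum>m<m. (x gchoose m) * (q - 1) ^ m) - (\<Sum>m<M. (x gchoose m) * (q - 1) ^ m)"
            "(\<Sum>m<n. (x gchoose m) * (q - 1) ^ m) - (\<Sum>m<M. (x gchoose m) * (q - 1) ^ m)"]
        by (simp add: dist_pabs)
    qed
  qed
  then have "convergent (\<lambda>N. \<Sum>m<N. (x gchoose m) * (q - 1) ^ m)"
    by (rule Cauchy_convergent)
  then have "summable (\<lambda>m. (x gchoose m) * (q - 1) ^ m)"
    by (simp add: summable_iff_convergent)
  then show ?thesis
    unfolding ppow_def sums_def suminf_eq_lim summable_iff_convergent by (rule convergent_LIMSEQ_iff[THEN iffD1])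
qed

lemma pabs_ppow_partial_le:
  fixes x :: 'a
  assumes "pabs (1 - q) < 1" "x \<in> Zp"
  shows "pabs (ppow q x - (\<Sum>m<M. (x gchoose m) * (q - 1) ^ m)) \<le> pabs (q - 1) ^ M"
proof (rule field_le_epsilon)
  fix e :: real assume "e > 0"
  let ?S = "\<lambda>N. \<Sum>m<N. (x gchoose m) * (q - 1) ^ m"
  have "\<forall>\<^sub>F N in sequentially. pabs (?S N - ppow q x) < e"
    using ppow_sums[OF assms] \<open>e > 0\<close> unfolding sums_def tendsto_iff_pabs by (rule order_tendstoD)
  then obtain N where N: "\<And>n. n \<ge> N \<Longrightarrow> pabs (?S n - ppow q x) < e"
    by (auto simp: eventually_sequentially)
  show "pabs (ppow q x - ?S M) \<le> pabs (q - 1) ^ M + e"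
    using pabs_diff_ultra[of "?S (max M N) - ?S M" "?S (max M N) - ppow q x"] N[of "max M N"]
      pabs_binomial_tail_le[OF assms, of M "max M N"] \<open>e > 0\<close> zero_le_power[OF pabs_nonneg[of "q - 1"], of M]
    by auto
qed

text \<open>A uniform limit of polynomials: \<open>?S\<close> is continuous and stays within |q -
  1|^M < e of q^x on all of \<open>Zp\<close>. In an ultrametric the three errors may each be
  bounded by the same e.\<close>

lemma tendsto_ppow:
  fixes x :: 'a
  assumes q: "pabs (1 - q) < 1" and "x \<in> Zp" "\<And>k. X k \<in> Zp" "X \<longlonglongrightarrow> x"
  shows "(\<lambda>k. ppow q (X k)) \<longlonglongrightarrow> ppow q x"
proof (rule metric_LIMSEQ_I)
  fix e :: real assume "e > 0"
  then have "\<forall>\<^sub>F M in sequentially. pabs (q - 1) ^ M < e"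
    using pabs_power_tendsto_0[OF q] by (auto intro: order_tendstoD)
  then obtain M where M: "pabs (q - 1) ^ M < e"
    by (auto simp: eventually_sequentially)
  let ?S = "\<lambda>x. \<Sum>m<M. (x gchoose m) * (q - 1) ^ m"
  have "(\<lambda>k. ?S (X k)) \<longlonglongrightarrow> ?S x"
    by (intro tendsto_sum_pabs tendsto_mult_pabs tendsto_const tendsto_gbinomial_pabs assms)
  then have "\<forall>\<^sub>F k in sequentially. pabs (?S (X k) - ?S x) < e"
    using \<open>e > 0\<close> unfolding tendsto_iff_pabs by (rule order_tendstoD)
  then obtain K where K: "\<And>k. k \<ge> K \<Longrightarrow> pabs (?S (X k) - ?S x) < e"
    by (auto simp: eventually_sequentially)
  show "\<exists>K. \<forall>k\<ge>K. dist (ppow q (X k)) (ppow q x) < e"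
  proof (intro exI allI impI)
    fix k assume "k \<ge> K"
    then have "pabs (?S (X k) - ?S x) < e"
      by (rule K)
    moreover have "pabs (ppow q (X k) - ?S (X k)) < e" "pabs (ppow q x - ?S x) < e"
      using pabs_ppow_partial_le[OF q, of _ M] assms M by (meson le_less_trans)+
    ultimately have "pabs ((ppow q (X k) - ?S (X k)) - (ppow q x - ?S x) + (?S (X k) - ?S x)) < e"
      using pabs_ultra[of "(ppow q (X k) - ?S (X k)) - (ppow q x - ?S x)" "?S (X k) - ?S x"]
        pabs_diff_ultra[of "ppow q (X k) - ?S (X k)" "ppow q x - ?S x"] by linarith
    then show "dist (ppow q (X k)) (ppow q x) < e"
      by (simp add: dist_pabs)
  qed
qed

section \<open>Functional equations of q^x\<close>

lemma ppow_add_1: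
  fixes x :: 'a
  assumes "pabs (1 - q) < 1" "x \<in> Zp"
  shows "ppow q (x + 1) = q * ppow q x"
proof -
  let ?f = "\<lambda>x m. (x gchoose m) * (q - 1) ^ m"
  have S: "?f x sums ppow q x" and S1: "?f (x + 1) sums ppow q (x + 1)"
    using assms Zp_add_of_nat[OF assms(2), of 1] by (auto intro!: ppow_sums)
  \<comment> \<open>Pascal's rule splits each coefficient at x + 1; the index shift in one half
    costs one term and produces the factor q - 1.\<close>
  have "(\<Sum>m<Suc N. ?f (x + 1) m) = (q - 1) * (\<Sum>m<N. ?f x m) + (\<Sum>m<Suc N. ?f x m)" for N
    by (simp only: sum.lessThan_Suc_shift gbinomial_Suc_Suc)
      (simp add: algebra_simps sum.distrib sum_distrib_left sum_subtractf)
  moreover have "(\<lambda>N. (q - 1) * (\<Sum>m<N. ?f x m) + (\<Sum>m<Suc N. ?f x m)) \<longlonglongrightarrow> (q - 1) * ppow q x + ppow q x"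
    using S unfolding sums_def by (intro tendsto_add_pabs tendsto_mult_left_pabs LIMSEQ_Suc)
  moreover have "(\<lambda>N. \<Sum>m<Suc N. ?f (x + 1) m) \<longlonglongrightarrow> ppow q (x + 1)"
    using S1 unfolding sums_def by (rule LIMSEQ_Suc)
  ultimately have "ppow q (x + 1) = (q - 1) * ppow q x + ppow q x"
    by (metis (no_types, lifting) LIMSEQ_unique ext)
  then show ?thesis
    by (simp add: algebra_simps)
qed

lemma ppow_add_of_nat:
  fixes x :: 'a
  assumes "pabs (1 - q) < 1" "x \<in> Zp"
  shows "ppow q (x + of_nat k) = ppow q x * q ^ k"
proof (induction k)
  case (Suc k)
  have "ppow q (x + of_nat (Suc k)) = ppow q (x + of_nat k + 1)"
    by (simp add: add_ac)
  then show ?case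
    using ppow_add_1[OF assms(1) Zp_add_of_nat[OF assms(2)], of k] Suc by simp
qed simp

lemma unit_ball_nonzero:
  assumes "pabs (1 - q) < 1"
  shows "q \<noteq> 0"
  using assms by auto

lemma ppow_of_int:
  assumes "pabs (1 - q) < 1"
  shows "ppow q (of_int k) = q powi k"
proof (cases k rule: int_cases2)
  case (nonneg n)
  then show ?thesis
    by (simp add: ppow_of_nat)
next
  case (nonpos n)
  \<comment> \<open>Multiplying by q^n moves the exponent -n to 0, where the value is 1.\<close>
  have "ppow q (of_int k) * q ^ n = ppow q (of_int k + of_nat n)"
    by (rule ppow_add_of_nat[symmetric]) (use assms in simp_all)
  also have "\<dots> = 1"
    using ppow_of_nat[of q 0] nonpos by simp
  finally show ?thesis
    using nonpos unit_ball_nonzero[OF assms] by (simp add: power_int_minus field_simps)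
qed

text \<open>Both sides are continuous in x and equal the same ordinary power of q at natural
  x.\<close>

lemma ppow_of_nat_mult:
  fixes x :: 'a
  assumes "pabs (1 - q) < 1" "x \<in> Zp"
  shows "ppow q (of_nat l * x) = ppow q x ^ l"
proof -
  obtain K :: "nat \<Rightarrow> nat" where K: "(\<lambda>j. of_nat (K j)) \<longlonglongrightarrow> x"
    using Zp_seq assms by blast
  have "(\<lambda>j. ppow q (of_nat (l * K j))) \<longlonglongrightarrow> ppow q (of_nat l * x)"
    unfolding of_nat_mult
    by (intro tendsto_ppow tendsto_mult_left_pabs K assms Zp_of_nat_mult of_nat_in_Zp)
  moreover have "(\<lambda>j. ppow q (of_nat (K j)) ^ l) \<longlonglongrightarrow> ppow q x ^ l"
    by (intro tendsto_power_pabs tendsto_ppow K assms of_nat_in_Zp)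
  ultimately show ?thesis
    unfolding ppow_of_nat power_mult[symmetric] mult.commute[of l] by (rule LIMSEQ_unique)
qed

section \<open>The ball |1 - a| < 1 as a multiplicative group\<close>

lemma unit_ball_mult:
  assumes "pabs (1 - a) < 1" "pabs (1 - b) < 1"
  shows "pabs (1 - a * b) < 1"
proof -
  have "pabs a \<le> 1"
    using pabs_diff_ultra[of 1 "1 - a"] assms(1) by simp
  \<comment> \<open>Prepares the splitting 1 - ab = (1 - a) + a(1 - b).\<close>
  then have "pabs (a * (1 - b)) < 1"
    using mult_left_le_one_le[OF pabs_nonneg pabs_nonneg, of a "1 - b"] assms(2)
    by (simp add: pabs_mult)
  then show ?thesis
    using pabs_ultra[of "1 - a" "a * (1 - b)"] assms(1) by (simp add: algebra_simps)
qed

lemma unit_ball_inverse: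
  assumes "pabs (1 - a) < 1"
  shows "pabs (1 - inverse a) < 1"
proof -
  have "pabs a = 1"
    using pabs_diff_ultra[of 1 "1 - a"] pabs_ultra[of "1 - a" a] assms by auto
  moreover have "1 - inverse a = - (1 - a) * inverse a"
    using unit_ball_nonzero[OF assms] by (simp add: algebra_simps)
  ultimately show ?thesis
    using assms by (simp add: pabs_mult pabs_inverse del: minus_diff_eq)
qed

lemma unit_ball_power:
  assumes "pabs (1 - a) < 1"
  shows "pabs (1 - a ^ k) < 1"
  by (induction k) (simp_all add: unit_ball_mult assms)

lemma unit_ball_powi:
  assumes "pabs (1 - a) < 1"
  shows "pabs (1 - a powi k) < 1"
  by (simp add: power_int_def unit_ball_power unit_ball_inverse assms)

section \<open>Fermionic integrals of sums of exponentials\<close>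

lemma one_plus_unit_ball_nonzero:
  assumes "odd p" "pabs (1 - a) < 1"
  shows "1 + a \<noteq> 0"
proof
  assume "1 + a = 0"
  then have "a = - 1"
    by (simp add: add_eq_0_iff)
  \<comment> \<open>For odd p the integer 2 is a unit, while a = -1 would give |2| = |1 - a| <
    1.\<close>
  moreover have "pabs (of_int 2) = 1"
    using assms(1) by (intro pabs_of_int_eq_1) simp
  ultimately show False
    using assms(2) by simp
qed

text \<open>The defining limit evaluates f only at natural numbers, so the exponential form is asked
  for only there.\<close>

lemma fermionic_integral_exponential_sum:
  assumes "odd p" "finite L" "\<And>l. l \<in> L \<Longrightarrow> pabs (1 - a l) < 1"
    and f: "\<And>k. f (of_nat k) = (\<Sum>l\<in>L. c l * a l ^ k)"
  shows "fermionic_integral p f = (\<Sum>l\<in>L. c l * (2 / (1 + a l)))"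
proof -
  have a: "1 + a l \<noteq> 0" if "l \<in> L" for l
    using one_plus_unit_ball_nonzero assms that by blast
  have "(\<Sum>x<p ^ N. f (of_nat x) * (- 1) ^ x) = (\<Sum>l\<in>L. c l / (1 + a l) * (1 + a l ^ (p ^ N)))" for N
  proof -
    have "(\<Sum>x<p ^ N. f (of_nat x) * (- 1) ^ x) = (\<Sum>l\<in>L. c l * (\<Sum>x<p ^ N. (- a l) ^ x))"
      unfolding f sum_distrib_right sum_distrib_left
      by (subst sum.swap) (simp add: power_minus[of "a _"] mult_ac)
    also have "\<dots> = (\<Sum>l\<in>L. c l / (1 + a l) * (1 + a l ^ (p ^ N)))"
    proof (rule sum.cong[OF refl])
      fix l assume "l \<in> L"
      have "- a l \<noteq> 1"
        using a[OF \<open>l \<in> L\<close>] by (metis add.right_inverse minus_equation_iff add.commute)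
      then have "(\<Sum>x<p ^ N. (- a l) ^ x) = (1 - (- a l) ^ (p ^ N)) / (1 + a l)"
        using sum_gp_strict[of "- a l" "p ^ N"] by simp
      \<comment> \<open>p^N is odd for every N, including N = 0, so the sign comes out.\<close>
      also have "(- a l) ^ (p ^ N) = - (a l ^ (p ^ N))"
        using assms(1) by simp
      finally show "c l * (\<Sum>x<p ^ N. (- a l) ^ x) = c l / (1 + a l) * (1 + a l ^ (p ^ N))"
        by simp
    qed
    finally show ?thesis .
  qed
  moreover have "(\<lambda>N. \<Sum>l\<in>L. c l / (1 + a l) * (1 + a l ^ (p ^ N))) \<longlonglongrightarrow> (\<Sum>l\<in>L. c l / (1 + a l) * (1 + 1))"
  proof (intro tendsto_sum_pabs tendsto_mult_left_pabs tendsto_add_pabs tendsto_const)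
    fix l assume "l \<in> L"
    have "(\<lambda>N. of_nat (p ^ N)) \<longlonglongrightarrow> (of_nat 0 :: 'a)"
      unfolding tendsto_iff_pabs using p_gt_1
      by (simp add: pabs_power pabs_p LIMSEQ_realpow_zero)
    then have "(\<lambda>N. ppow (a l) (of_nat (p ^ N))) \<longlonglongrightarrow> ppow (a l) (of_nat 0)"
      using assms(3)[OF \<open>l \<in> L\<close>] by (intro tendsto_ppow of_nat_in_Zp)
    then show "(\<lambda>N. a l ^ (p ^ N)) \<longlonglongrightarrow> 1"
      unfolding ppow_of_nat by simp
  qed
  ultimately have "(\<lambda>N. \<Sum>x<p ^ N. f (of_nat x) * (- 1) ^ x) \<longlonglongrightarrow> (\<Sum>l\<in>L. c l * (2 / (1 + a l)))"
    by simp
  then show ?thesis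
    unfolding fermionic_integral_def by (rule limI)
qed

text \<open>Induction on r: fixing the outermost variable at m absorbs
  \<open>a l (Suc r) ^ m\<close> into the coefficient, so \<open>c\<close> has to vary along with
  \<open>f\<close>.\<close>

lemma fermionic_integral_iter_exponential_sum:
  assumes "odd p" "finite L" "\<And>l i. l \<in> L \<Longrightarrow> pabs (1 - a l i) < 1"
    and "\<And>k. f (\<lambda>i. of_nat (k i)) = (\<Sum>l\<in>L. c l * (\<Prod>i=1..r. a l i ^ k i))"
  shows "fermionic_integral_iter p r f = (\<Sum>l\<in>L. c l * (\<Prod>i=1..r. 2 / (1 + a l i)))"
  using assms(4)
proof (induction r arbitrary: f c)
  case 0
  then show ?case
    \<comment> \<open>The 0-fold integral evaluates at the zero family, which is the image of the
      zero family of naturals.\<close>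
    using 0[of "\<lambda>_. 0"] by simp
next
  case (Suc r)
  have inner: "fermionic_integral_iter p r (\<lambda>X. f (X(Suc r := of_nat m))) =
      (\<Sum>l\<in>L. (c l * a l (Suc r) ^ m) * (\<Prod>i=1..r. 2 / (1 + a l i)))" for m
  proof (rule Suc.IH)
    fix k :: "nat \<Rightarrow> nat"
    have upd: "(\<lambda>i. of_nat (k i))(Suc r := of_nat m) = (\<lambda>i. of_nat ((k(Suc r := m)) i) :: 'a)"
      by auto
    show "f ((\<lambda>i. of_nat (k i))(Suc r := of_nat m)) =
        (\<Sum>l\<in>L. c l * a l (Suc r) ^ m * (\<Prod>i=1..r. a l i ^ k i))"
      unfolding upd Suc.prems by (simp add: mult_ac)
  qed
  have "fermionic_integral_iter p (Suc r) f =
      (\<Sum>l\<in>L. (c l * (\<Prod>i=1..r. 2 / (1 + a l i))) * (2 / (1 + a l (Suc r))))"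
    unfolding fermionic_integral_iter.simps
    by (rule fermionic_integral_exponential_sum) (use assms inner in \<open>simp_all add: mult_ac\<close>)
  then show ?case
    by (simp add: mult_ac)
qed

section \<open>The closed form of \<open>twisted_q_Euler\<close>\<close>

lemma qnum_add_of_nat_power:
  fixes x :: 'a
  assumes "pabs (1 - q) < 1" "x \<in> Zp"
  shows "qnum q (x + of_nat m) ^ n =
    (\<Sum>l\<le>n. of_nat (n choose l) * (- 1) ^ l * ppow q (of_nat l * x) / (1 - q) ^ n * (q ^ l) ^ m)"
proof -
  \<comment> \<open>Expanded binomially so that m enters each term only through the exponential
    (q^l)^m.\<close>
  have "(1 - ppow q x * q ^ m) ^ n = (\<Sum>l\<le>n. of_nat (n choose l) * (- (ppow q x * q ^ m)) ^ l)"
    using binomial_ring[of "- (ppow q x * q ^ m)" 1 n] by simp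
  moreover have "(- (ppow q x * q ^ m)) ^ l = (- 1) ^ l * ppow q (of_nat l * x) * (q ^ l) ^ m" for l
    unfolding power_minus[of "ppow q x * q ^ m"] ppow_of_nat_mult[OF assms]
    by (simp add: power_mult_distrib power_mult[symmetric] mult.commute)
  ultimately show ?thesis
    unfolding qnum_def ppow_add_of_nat[OF assms] power_divide
    by (simp add: sum_divide_distrib mult_ac)
qed

lemma twisted_q_Euler_eq:
  fixes q w x :: 'a
  assumes "odd p" "pabs (1 - q) < 1" "pabs (1 - w) < 1" "x \<in> Zp"
  shows "twisted_q_Euler p h r n w q x =
    (\<Sum>l\<le>n. of_nat (n choose l) * (- 1) ^ l * ppow q (of_nat l * x) / (1 - q) ^ n *
      (2 ^ r / qshift (- (q powi (int l + h)) * w) (inverse q) r))"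
proof -
  define c where "c l = of_nat (n choose l) * (- 1) ^ l * ppow q (of_nat l * x) / (1 - q) ^ n" for l
  \<comment> \<open>The base belonging to x_i: w from the twist, q^l from the l-th binomial term,
    q^(h-i+1) from the weight.\<close>
  define a where "a l i = w * q powi (int l + (h - int i + 1))" for l i :: nat
  have q0: "q \<noteq> 0"
    using assms(2) by (rule unit_ball_nonzero)
  have "twisted_q_Euler p h r n w q x = (\<Sum>l\<le>n. c l * (\<Prod>i=1..r. 2 / (1 + a l i)))"
    unfolding twisted_q_Euler_def
  proof (rule fermionic_integral_iter_exponential_sum)
    show "pabs (1 - a l i) < 1" for l i
      unfolding a_def by (intro unit_ball_mult unit_ball_powi assms)
  next
    fix k :: "nat \<Rightarrow> nat"
    \<comment> \<open>At natural arguments the weight exponent is an integer, possibly negative, so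
      the power becomes a \<open>powi\<close>.\<close>
    have "(\<Sum>i=1..r. (of_int h - of_nat i + 1) * of_nat (k i)) = (of_int (\<Sum>i=1..r. (h - int i + 1) * int (k i)) :: 'a)"
      by simp
    then have "ppow q (\<Sum>i=1..r. (of_int h - of_nat i + 1) * of_nat (k i))
        = q powi (\<Sum>i=1..r. (h - int i + 1) * int (k i))"
      by (simp only: ppow_of_int[OF assms(2)])
    also have "\<dots> = (\<Prod>i=1..r. (q powi (h - int i + 1)) ^ k i)"
      using q0
      by (induction r) (simp_all add: power_int_add power_int_mult del: of_nat_Suc power_int_add_1 power_int_add_1')
    finally have Q: "ppow q (\<Sum>i=1..r. (of_int h - of_nat i + 1) * of_nat (k i))
        = (\<Prod>i=1..r. (q powi (h - int i + 1)) ^ k i)" .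
    have prod: "w ^ (\<Sum>i=1..r. k i) * ((q ^ l) ^ (\<Sum>i=1..r. k i)) * (\<Prod>i=1..r. (q powi (h - int i + 1)) ^ k i)
        = (\<Prod>i=1..r. a l i ^ k i)" for l
      using q0
      by (simp add: a_def power_sum prod.distrib[symmetric] power_mult_distrib[symmetric]
          power_int_add mult_ac)
    show "ppow w (\<Sum>i=1..r. of_nat (k i)) * qnum q (x + (\<Sum>i=1..r. of_nat (k i))) ^ n *
        ppow q (\<Sum>i=1..r. (of_int h - of_nat i + 1) * of_nat (k i))
        = (\<Sum>l\<le>n. c l * (\<Prod>i=1..r. a l i ^ k i))"
      unfolding Q of_nat_sum[symmetric] ppow_of_nat qnum_add_of_nat_power[OF assms(2,4)]
        c_def[symmetric] prod[symmetric]
      by (simp add: sum_distrib_left sum_distrib_right mult_ac)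
  qed (use assms in auto)
  also have "\<dots> = (\<Sum>l\<le>n. c l * (2 ^ r / qshift (- (q powi (int l + h)) * w) (inverse q) r))"
  proof (intro sum.cong refl arg_cong2[where f = "(*)"])
    fix l
    \<comment> \<open>With i = j + 1 the bases form a geometric progression of ratio 1/q starting at
      q^(l+h) w, so the denominators multiply to a q-shift factorial in base 1/q.\<close>
    have "a l (Suc j) = q powi (int l + h) * w * inverse q ^ j" for j
    proof -
      have "int l + (h - int (Suc j) + 1) = int l + h - int j"
        by simp
      then show ?thesis
        by (simp only: a_def power_int_diff[OF disjI1[OF q0]])
          (simp add: divide_inverse power_inverse mult_ac)
    qed
    then have "(\<Prod>i=1..r. 1 + a l i) = qshift (- (q powi (int l + h)) * w) (inverse q) r"
      unfolding qshift_def One_nat_def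
      by (subst atLeastLessThanSuc_atLeastAtMost[symmetric], subst prod.atLeast_Suc_lessThan_Suc_shift)
        (simp add: lessThan_atLeast0)
    then show "(\<Prod>i=1..r. 2 / (1 + a l i)) = 2 ^ r / qshift (- (q powi (int l + h)) * w) (inverse q) r"
      by (simp add: prod_dividef)
  qed
  finally show ?thesis
    unfolding c_def .
qed

text \<open>Each factor is 1 plus an element of the ball around 1. This makes the generating
  functions below regular at t = 1.\<close>

lemma qshift_nonzero:
  assumes "odd p" "pabs (1 - q) < 1" "pabs (1 - w) < 1"
  shows "qshift (- (q powi k) * w) (inverse q) r \<noteq> 0"
proof -
  have "1 + q powi k * w * inverse q ^ j \<noteq> 0" for j
    by (intro one_plus_unit_ball_nonzero unit_ball_mult unit_ball_powi unit_ball_power unit_ball_inverse assms)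
  then show ?thesis
    by (simp add: qshift_def)
qed

end

section \<open>Arithmetic of rational sums and the q-binomial theorem\<close>

lemma rational_sums_add:
  assumes "a rational_sums s" "b rational_sums t"
  shows "(\<lambda>m. a m + b m) rational_sums (s + t)"
proof -
  obtain P Q where 1: "poly Q 1 \<noteq> 0" "fps_of_poly Q * Abs_fps a = fps_of_poly P" "s = poly P 1 / poly Q 1"
    using assms(1) unfolding rational_sums_def by blast
  obtain P' Q' where 2: "poly Q' 1 \<noteq> 0" "fps_of_poly Q' * Abs_fps b = fps_of_poly P'" "t = poly P' 1 / poly Q' 1"
    using assms(2) unfolding rational_sums_def by blast
  have "Abs_fps (\<lambda>m. a m + b m) = Abs_fps a + Abs_fps b"
    by (rule fps_ext) simp
  then have "fps_of_poly (Q * Q') * Abs_fps (\<lambda>m. a m + b m) = fps_of_poly (P * Q' + P' * Q)"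
    by (simp add: fps_of_poly_mult fps_of_poly_add 1(2)[symmetric] 2(2)[symmetric] algebra_simps)
  moreover have "s + t = poly (P * Q' + P' * Q) 1 / poly (Q * Q') 1"
    unfolding 1(3) 2(3) using 1(1) 2(1) by (simp add: field_simps)
  ultimately show ?thesis
    unfolding rational_sums_def using 1(1) 2(1)
    by (intro exI[of _ "P * Q' + P' * Q"] exI[of _ "Q * Q'"]) auto
qed

lemma rational_sums_mult:
  assumes "a rational_sums s"
  shows "(\<lambda>m. c * a m) rational_sums (c * s)"
proof -
  obtain P Q where 1: "poly Q 1 \<noteq> 0" "fps_of_poly Q * Abs_fps a = fps_of_poly P" "s = poly P 1 / poly Q 1"
    using assms unfolding rational_sums_def by blast
  have "Abs_fps (\<lambda>m. c * a m) = fps_const c * Abs_fps a"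
    by (rule fps_ext) simp
  then have "fps_of_poly Q * Abs_fps (\<lambda>m. c * a m) = fps_of_poly (smult c P)"
    by (simp add: fps_of_poly_smult 1(2)[symmetric] mult_ac)
  then show ?thesis
    unfolding rational_sums_def using 1 by (intro exI[of _ "smult c P"] exI[of _ Q]) auto
qed

lemma rational_sums_0: "(\<lambda>_. 0) rational_sums 0"
proof -
  have "Abs_fps (\<lambda>_. 0 :: 'a) = 0"
    by (rule fps_ext) simp
  then show ?thesis
    unfolding rational_sums_def by (intro exI[of _ 0] exI[of _ 1]) simp
qed

lemma rational_sums_sum:
  assumes "\<And>l. l \<in> L \<Longrightarrow> a l rational_sums s l"
  shows "(\<lambda>m. \<Sum>l\<in>L. a l m) rational_sums (\<Sum>l\<in>L. s l)"
  using assms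
  by (induction L rule: infinite_finite_induct) (simp_all add: rational_sums_0 rational_sums_add)

text \<open>The recurrence says (1 - ct) B(t) = A(t) for the generating functions, and c \<noteq> 1
  keeps the new denominator nonzero at t = 1.\<close>

lemma rational_sums_linear_factor:
  fixes a b :: "nat \<Rightarrow> 'a::field"
  assumes "a rational_sums s" "c \<noteq> 1" "b 0 = a 0" "\<And>m. b (Suc m) = c * b m + a (Suc m)"
  shows "b rational_sums (s / (1 - c))"
proof -
  obtain P Q where 1: "poly Q 1 \<noteq> 0" "fps_of_poly Q * Abs_fps a = fps_of_poly P" "s = poly P 1 / poly Q 1"
    using assms(1) unfolding rational_sums_def by blast
  have "fps_of_poly [:1, - c:] * Abs_fps b = Abs_fps a"
  proof (rule fps_ext)
    fix n
    show "fps_nth (fps_of_poly [:1, - c:] * Abs_fps b) n = fps_nth (Abs_fps a) n"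
      by (cases n) (simp_all add: fps_of_poly_pCons algebra_simps assms)
  qed
  then have "fps_of_poly (Q * [:1, - c:]) * Abs_fps b = fps_of_poly P"
    by (simp only: fps_of_poly_mult mult.assoc 1(2))
  then show ?thesis
    unfolding rational_sums_def 1(3) using 1(1) assms(2)
    by (intro exI[of _ P] exI[of _ "Q * [:1, - c:]"]) (simp add: algebra_simps)
qed

text \<open>Induction on r: the q-Pascal rule adjoins the factor 1 - z q^r t to the denominator of
  the generating function. The condition on q keeps the denominators 1 - q^(i+1) nonzero.\<close>

lemma rational_sums_q_binomial:
  fixes q z :: "'a::field"
  assumes "\<And>k. k \<ge> 1 \<Longrightarrow> q ^ k \<noteq> 1" "qshift z q r \<noteq> 0"
  shows "(\<lambda>m. (\<Prod>i<m. (1 - q ^ (r + i)) / (1 - q ^ Suc i)) * z ^ m) rational_sums (1 / qshift z q r)"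
  using assms(2)
proof (induction r)
  case 0
  \<comment> \<open>For r = 0 the factor at i = 0 vanishes, leaving only the term m = 0.\<close>
  have "(\<Prod>i<m. (1 - q ^ (0 + i)) / (1 - q ^ Suc i)) * z ^ m = 0 ^ m" for m
    by (cases m) (simp_all add: prod.lessThan_Suc_shift del: power_Suc prod.lessThan_Suc)
  then show ?case
    using rational_sums_geometric[of "0 :: 'a"] by (simp add: qshift_def)
next
  case (Suc r)
  define B where "B r m = (\<Prod>i<m. (1 - q ^ (r + i)) / (1 - q ^ Suc i))" for r m
  have nz: "qshift z q r \<noteq> 0" "z * q ^ r \<noteq> 1"
    using Suc.prems by (auto simp: qshift_def)
  have "(\<lambda>m. B (Suc r) m * z ^ m) rational_sums (1 / qshift z q r / (1 - z * q ^ r))"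
  proof (rule rational_sums_linear_factor)
    show "(\<lambda>m. B r m * z ^ m) rational_sums (1 / qshift z q r)"
      unfolding B_def using nz by (intro Suc.IH)
  next
    fix m
    define D where "D = (\<Prod>i<m. 1 - q ^ Suc i)"
    have qm: "1 - q ^ Suc m \<noteq> 0"
      using assms(1)[of "Suc m"] by auto
    \<comment> \<open>Peeling off the first numerator factor leaves the numerator of
      \<open>B (Suc r) m\<close>.\<close>
    have "B r (Suc m) = (1 - q ^ r) * (\<Prod>i<m. 1 - q ^ (Suc r + i)) / (D * (1 - q ^ Suc m))"
      unfolding B_def prod_dividef prod.lessThan_Suc_shift[of "\<lambda>i. 1 - q ^ (r + i)"]
      by (simp add: D_def)
    then have "B r (Suc m) = B (Suc r) m * ((1 - q ^ r) / (1 - q ^ Suc m))"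
      by (simp add: B_def[of "Suc r" m] prod_dividef D_def mult_ac del: prod.lessThan_Suc)
    moreover have "B (Suc r) (Suc m) = B (Suc r) m * ((1 - q ^ (Suc r + m)) / (1 - q ^ Suc m))"
      by (simp add: B_def)
    \<comment> \<open>The q-Pascal identity, from 1 - q^(r+1+m) = q^r (1 - q^(m+1)) + (1 -
      q^r).\<close>
    moreover have "(1 - q ^ (Suc r + m)) / (1 - q ^ Suc m) = q ^ r + (1 - q ^ r) / (1 - q ^ Suc m)"
      using qm by (simp add: field_simps power_add)
    ultimately have "B (Suc r) (Suc m) = q ^ r * B (Suc r) m + B r (Suc m)"
      by (simp only: distrib_left mult.commute)
    then show "B (Suc r) (Suc m) * z ^ Suc m = z * q ^ r * (B (Suc r) m * z ^ m) + B r (Suc m) * z ^ Suc m"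
      by (simp add: algebra_simps)
  qed (use nz in \<open>simp_all add: B_def\<close>)
  then show ?case
    unfolding B_def by (simp add: qshift_def)
qed

theorem theorem7:
  fixes p :: nat and pabs :: "'a::{field_char_0, complete_space} \<Rightarrow> real"
    and q w x :: 'a and h :: int and r n :: nat
  assumes "padic_complex p pabs" and "odd p"
    and "pabs (1 - q) < 1" and "pabs (1 - w) < 1" and "q \<noteq> 1"
    and "r \<ge> 1" and "x \<in> Zp"
  shows
    "twisted_q_Euler p h r n w q x =
       2 ^ r / (1 - q) ^ n *
         (\<Sum>l=0..n. of_nat (n choose l) * (- 1) ^ l * ppow q (of_nat l * x) /
            qshift (- (q powi (int l + h)) * w) (inverse q) r)
     \<and>
     ((\<forall>k\<ge>1. q ^ k \<noteq> 1) \<longrightarrow>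
       (\<exists>S. (\<lambda>m. qbinom (inverse q) (m + r - 1) m * (- 1) ^ m * q powi (h * int m) * w ^ m *
                 qnum q (of_nat m + x) ^ n) rational_sums S \<and>
            twisted_q_Euler p h r n w q x = 2 ^ r * S))"
proof (intro conjI impI)
  interpret padic_complex p pabs
    by fact
  have q0: "q \<noteq> 0"
    using assms(3) by (rule unit_ball_nonzero)
  \<comment> \<open>The coefficient \<open>c l\<close> is common to the integral and the series, so
    the two can be compared for each l.\<close>
  define c where "c l = of_nat (n choose l) * (- 1) ^ l * ppow q (of_nat l * x) / (1 - q) ^ n" for l
  define d where "d l = qshift (- (q powi (int l + h)) * w) (inverse q) r" for l :: nat
  have E: "twisted_q_Euler p h r n w q x = (\<Sum>l\<le>n. c l * (2 ^ r / d l))"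
    unfolding c_def d_def using assms by (intro twisted_q_Euler_eq)
  then show "twisted_q_Euler p h r n w q x =
       2 ^ r / (1 - q) ^ n *
         (\<Sum>l=0..n. of_nat (n choose l) * (- 1) ^ l * ppow q (of_nat l * x) /
            qshift (- (q powi (int l + h)) * w) (inverse q) r)"
    unfolding c_def d_def sum_distrib_left atLeast0AtMost by (simp add: mult_ac)
  assume nontorsion: "\<forall>k\<ge>1. q ^ k \<noteq> 1"
  let ?B = "\<lambda>m. \<Prod>i<m. (1 - inverse q ^ (r + i)) / (1 - inverse q ^ Suc i)"
  \<comment> \<open>The q-binomial theorem in base 1/q with z = -q^(l+h) w, combined linearly over
    l.\<close>
  have "(\<lambda>m. \<Sum>l\<le>n. c l * (?B m * (- (q powi (int l + h)) * w) ^ m)) rational_sums (\<Sum>l\<le>n. c l * (1 / d l))"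
    unfolding d_def
  proof (intro rational_sums_sum rational_sums_mult rational_sums_q_binomial qshift_nonzero assms)
    show "inverse q ^ k \<noteq> 1" if "k \<ge> 1" for k
      using nontorsion that by (metis inverse_1 inverse_inverse_eq power_inverse)
  qed
  moreover have "(\<Sum>l\<le>n. c l * (?B m * (- (q powi (int l + h)) * w) ^ m)) =
      qbinom (inverse q) (m + r - 1) m * (- 1) ^ m * q powi (h * int m) * w ^ m *
        qnum q (of_nat m + x) ^ n" for m
  proof -
    \<comment> \<open>Isolates (q^l)^m, the only part depending on l, so that the sum over l
      reassembles [m+x]^n.\<close>
    have "(- (q powi (int l + h)) * w) ^ m = (- 1) ^ m * q powi (h * int m) * w ^ m * (q ^ l) ^ m" for l
    proof -
      have "(- (q powi (int l + h)) * w) ^ m = (- 1) ^ m * (q powi (int l + h)) ^ m * w ^ m"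
        unfolding power_mult_distrib power_minus[of "q powi (int l + h)"] ..
      also have "(q powi (int l + h)) ^ m = (q ^ l) ^ m * q powi (h * int m)"
        using q0 by (simp add: power_int_add power_mult_distrib power_int_mult)
      finally show ?thesis
        by (simp add: mult_ac)
    qed
    then show ?thesis
      using qbinom_eq_prod[of r "inverse q" m] assms(5,6)
      unfolding add.commute[of "of_nat m" x] qnum_add_of_nat_power[OF assms(3,7)] c_def
      by (simp add: sum_distrib_left mult_ac)
  qed
  ultimately have "(\<lambda>m. qbinom (inverse q) (m + r - 1) m * (- 1) ^ m * q powi (h * int m) * w ^ m *
                 qnum q (of_nat m + x) ^ n) rational_sums (\<Sum>l\<le>n. c l * (1 / d l))"
    by simp
  moreover have "twisted_q_Euler p h r n w q x = 2 ^ r * (\<Sum>l\<le>n. c l * (1 / d l))"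
    unfolding E sum_distrib_left by (simp add: mult_ac)
  ultimately show "\<exists>S. (\<lambda>m. qbinom (inverse q) (m + r - 1) m * (- 1) ^ m * q powi (h * int m) * w ^ m *
                 qnum q (of_nat m + x) ^ n) rational_sums S \<and>
            twisted_q_Euler p h r n w q x = 2 ^ r * S"
    by blast
qed

end
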